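(* Fix $r\in(0,1)$ and $p>1$. Then: (1) the function $q\mapsto\hat{K}_{p,q}(r)$ is strictly decreasing and log-convex on $(0,\infty)$; (2) the function $q\mapsto E_{p,q}(r)$ is strictly decreasing and log-convex on $(0,\infty)$. In particular, for all $r\in(0,1)$, $p>1$ and $q>1$, the following Turán type inequalities hold: $$\hat{K}_{p,q}(r)^2\le\hat{K}_{p,q-1}(r)\,\hat{K}_{p,q+1}(r),$$ $$E_{p,q}(r)^2\le E_{p,q-1}(r)\,E_{p,q+1}(r).$$
   Context: For $p>1$, $q>0$ and $r\in(0,1)$, define $$\hat{K}_{p,q}(r)=\int_0^1\frac{dt}{(1-t^q)^{1/p}(1-r^qt^q)^{1/p}},\qquad E_{p,q}(r)=\int_0^1\left(\frac{1-r^qt^q}{1-t^q}\right)^{1/p}dt.$$ A function $f:(0,\infty)\to(0,\infty)$ is log-convex if $f(\lambda x+(1-\lambda)y)\le f(x)^{\lambda}f(y)^{1-\lambda}$ for all $x,y>0$ and $\lambda\in[0,1]$. *)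

theory Defs
  imports "HOL-Analysis.Analysis"
begin

text \<open>The integrands may be unbounded as \<open>t\<close> tends to \<open>1\<close>; they are nonnegative, so the
  improper integral is rendered as the Lebesgue integral over the open unit interval.\<close>

definition Khat :: "real \<Rightarrow> real \<Rightarrow> real \<Rightarrow> real" where
  "Khat p q r =
     (LBINT t:{0<..<1}. 1 / ((1 - t powr q) powr (1 / p) * (1 - r powr q * t powr q) powr (1 / p)))"

definition Epq :: "real \<Rightarrow> real \<Rightarrow> real \<Rightarrow> real" where
  "Epq p q r =
     (LBINT t:{0<..<1}. ((1 - r powr q * t powr q) / (1 - t powr q)) powr (1 / p))"

text \<open>The first conjunct expresses that \<open>f\<close> maps \<open>(0, \<infinity>)\<close> into \<open>(0, \<infinity>)\<close>. Since a Bochner integral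
  of a non-integrable function is \<open>0\<close>, for \<open>Khat\<close> and \<open>Epq\<close> it also entails that the
  defining integrals converge.\<close>

definition log_convex :: "(real \<Rightarrow> real) \<Rightarrow> bool" where
  "log_convex f \<longleftrightarrow>
     (\<forall>x>0. f x > 0) \<and>
     (\<forall>x>0. \<forall>y>0. \<forall>\<theta>\<in>{0..1}.
        f (\<theta> * x + (1 - \<theta>) * y) \<le> f x powr \<theta> * f y powr (1 - \<theta>))"

end

theory Submission
  imports Defs
begin

text \<open>Put \<open>L a q = - ln (1 - exp (- a q))\<close>. With \<open>a = - ln t\<close> and \<open>b = - ln (r t)\<close>, the two
  integrands are \<open>exp ((L a q + L b q) / p)\<close> and \<open>exp ((L a q - L b q) / p)\<close>, where \<open>0 < a < b\<close>.
  Since \<open>L' = - a / (exp (a q) - 1)\<close> and \<open>L'' = (a / (2 sinh (a q / 2)))\<^sup>2\<close> (derivatives in \<open>q\<close>), and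
  both \<open>u / (exp u - 1)\<close> and \<open>u / sinh u\<close> decrease in \<open>u > 0\<close>, the sum and the difference are both
  convex and strictly decreasing in \<open>q\<close>. Strict monotonicity and log-convexity then pass from the
  integrands to the integrals; the Turan inequalities are log-convexity at the midpoint of
  \<open>q - 1\<close> and \<open>q + 1\<close>. The integrals converge because \<open>1 - t\<^sup>q \<ge> min 1 q (1 - t)\<close> and \<open>1 / p < 1\<close>.\<close>

section \<open>Strict monotonicity and log-convexity under the integral sign\<close>

text \<open>The difference of the integrands is nonnegative; were its integral zero, it would vanish
  almost everywhere, forcing \<open>A\<close> to be a null set.\<close>

lemma set_integral_strict_mono:
  fixes f g :: "'a \<Rightarrow> real"
  assumes f: "set_integrable M A f" and g: "set_integrable M A g"
    and A: "A \<in> sets M" "emeasure M A \<noteq> 0"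
    and less: "\<And>x. x \<in> A \<Longrightarrow> f x < g x"
  shows "(LINT x:A|M. f x) < (LINT x:A|M. g x)"
proof -
  define h where "h x = indicator A x *\<^sub>R (g x - f x)" for x
  have int: "integrable M h"
    using set_integral_diff(1)[OF g f] by (simp add: set_integrable_def h_def[abs_def])
  have nn: "0 \<le> h x" for x
    using less[of x] by (auto simp: h_def indicator_def)
  have "integral\<^sup>L M h \<noteq> 0"
  proof
    assume "integral\<^sup>L M h = 0"
    then have "AE x in M. h x = 0"
      using integral_nonneg_eq_0_iff_AE[OF int] nn by simp
    then have "AE x in M. x \<notin> A"
      by eventually_elim (use less in \<open>fastforce simp: h_def indicator_def\<close>)
    then show False
      using A AE_iff_null_sets[OF A(1)] by (auto simp: null_sets_def)
  qed
  moreover have "integral\<^sup>L M h \<ge> 0"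
    using nn by simp
  moreover have "integral\<^sup>L M h = (LINT x:A|M. g x) - (LINT x:A|M. f x)"
    using set_integral_diff(2)[OF g f] by (simp add: set_lebesgue_integral_def h_def[abs_def])
  ultimately show ?thesis by linarith
qed

lemma log_convex_pos: "log_convex f \<Longrightarrow> x > 0 \<Longrightarrow> f x > 0"
  by (simp add: log_convex_def)

lemma log_convexD:
  assumes "log_convex f" "x > 0" "y > 0" "0 \<le> \<theta>" "\<theta> \<le> 1"
  shows "f (\<theta> * x + (1 - \<theta>) * y) \<le> f x powr \<theta> * f y powr (1 - \<theta>)"
  using assms by (auto simp: log_convex_def)

lemma log_convex_exp:
  assumes "convex_on {0<..} f"
  shows "log_convex (\<lambda>x. exp (f x))"
proof -
  have "f (\<theta> * x + (1 - \<theta>) * y) \<le> \<theta> * f x + (1 - \<theta>) * f y"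
    if "x > 0" "y > 0" "\<theta> \<in> {0..1}" for x y \<theta>
    \<comment> \<open>\<open>convex_onD\<close> attaches its weight to the second point, hence
      \<open>1 - \<theta>\<close>.\<close>
    using that convex_onD[OF assms, of "1 - \<theta>" x y] by simp
  then show ?thesis
    by (simp add: log_convex_def powr_def mult_exp_exp)
qed

lemma log_convex_turan:
  assumes f: "log_convex f" and q: "q > 1"
  shows "(f q)\<^sup>2 \<le> f (q - 1) * f (q + 1)"
proof -
  have "f (1/2 * (q - 1) + (1 - 1/2) * (q + 1)) \<le> f (q - 1) powr (1/2) * f (q + 1) powr (1 - 1/2)"
    using q by (intro log_convexD[OF f]) auto
  moreover have "1/2 * (q - 1) + (1 - 1/2) * (q + 1) = q"
    by (simp add: field_simps)
  ultimately have le: "f q \<le> sqrt (f (q - 1)) * sqrt (f (q + 1))"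
    using log_convex_pos[OF f] q by (simp add: powr_half_sqrt less_imp_le)
  have "(f q)\<^sup>2 \<le> (sqrt (f (q - 1)) * sqrt (f (q + 1)))\<^sup>2"
    using le log_convex_pos[OF f, of q] q by (intro power_mono) auto
  also have "\<dots> = f (q - 1) * f (q + 1)"
    using log_convex_pos[OF f, of "q - 1"] log_convex_pos[OF f, of "q + 1"] q
    by (simp add: power_mult_distrib)
  finally show ?thesis .
qed

text \<open>Hoelder's inequality in disguise: normalising both factors to integral \<open>1\<close>, it is the
  integrated form of Young's inequality.\<close>

lemma log_convex_set_integral:
  fixes h :: "real \<Rightarrow> 'a \<Rightarrow> real"
  assumes int: "\<And>q. q > 0 \<Longrightarrow> set_integrable M A (h q)"
    and A: "A \<in> sets M" "emeasure M A \<noteq> 0"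
    and h: "\<And>t. t \<in> A \<Longrightarrow> log_convex (\<lambda>q. h q t)"
  shows "log_convex (\<lambda>q. LINT t:A|M. h q t)"
proof -
  define I where "I q = (LINT t:A|M. h q t)" for q
  have pos: "0 < I q" if "q > 0" for q
  proof -
    \<comment> \<open>Positivity is strict monotonicity of the integral against the zero
      function.\<close>
    have "(LINT t:A|M. 0) < I q"
      unfolding I_def
      using int that A log_convex_pos[OF h]
      by (intro set_integral_strict_mono) (auto simp: set_integrable_def)
    then show ?thesis by (simp add: set_lebesgue_integral_def)
  qed
  have "I (\<theta> * x + (1 - \<theta>) * y) \<le> I x powr \<theta> * I y powr (1 - \<theta>)"
    if xy: "x > 0" "y > 0" and \<theta>: "0 \<le> \<theta>" "\<theta> \<le> 1" for x y \<theta>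
  proof -
    define C where "C = I x powr \<theta> * I y powr (1 - \<theta>)"
    have C: "C > 0" using pos xy by (simp add: C_def less_imp_neq[symmetric])
    have z: "\<theta> * x + (1 - \<theta>) * y > 0"
      using xy \<theta> by (cases "\<theta> = 0") (auto intro: add_pos_nonneg)
    \<comment> \<open>Young's inequality for \<open>h x t / I x\<close> and
      \<open>h y t / I y\<close>, multiplied by \<open>C\<close>, which cancels the powers of
      \<open>I x\<close> and \<open>I y\<close> on the left.\<close>
    have bound: "h (\<theta> * x + (1 - \<theta>) * y) t
        \<le> C * \<theta> / I x * h x t + C * (1 - \<theta>) / I y * h y t" if "t \<in> A" for t
    proof -
      have hp: "h x t > 0" "h y t > 0" using h[OF that] xy log_convex_pos by auto
      have "(h x t / I x) powr \<theta> * (h y t / I y) powr (1 - \<theta>)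
          \<le> \<theta> * (h x t / I x) + (1 - \<theta>) * (h y t / I y)"
        using hp pos xy \<theta> by (intro Youngs_inequality_0) auto
      then have "C * ((h x t / I x) powr \<theta> * (h y t / I y) powr (1 - \<theta>))
          \<le> C * (\<theta> * (h x t / I x) + (1 - \<theta>) * (h y t / I y))"
        using C by simp
      moreover have "C * ((h x t / I x) powr \<theta> * (h y t / I y) powr (1 - \<theta>))
          = h x t powr \<theta> * h y t powr (1 - \<theta>)"
        using hp pos[OF xy(1)] pos[OF xy(2)] by (simp add: C_def powr_divide)
      ultimately show ?thesis
        using log_convexD[OF h[OF that] xy \<theta>] by (simp add: algebra_simps)
    qed
    have ix: "set_integrable M A (\<lambda>t. C * \<theta> / I x * h x t)"
      and iy: "set_integrable M A (\<lambda>t. C * (1 - \<theta>) / I y * h y t)"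
      using int xy by auto
    have "I (\<theta> * x + (1 - \<theta>) * y)
        \<le> (LINT t:A|M. C * \<theta> / I x * h x t + C * (1 - \<theta>) / I y * h y t)"
      unfolding I_def[of "\<theta> * x + (1 - \<theta>) * y"]
      using bound by (intro set_integral_mono int z set_integral_add(1) ix iy)
    also have "\<dots> = C * \<theta> / I x * I x + C * (1 - \<theta>) / I y * I y"
      by (subst set_integral_add(2)[OF ix iy], subst (1 2) set_integral_mult_right) (simp only: I_def)
    \<comment> \<open>Each normalised factor integrates to 1, and the weights
      \<open>\<theta>\<close> and \<open>1 - \<theta>\<close> add up to 1.\<close>
    also have "\<dots> = C"
      using pos[OF xy(1)] pos[OF xy(2)] by (simp add: field_simps)
    finally show ?thesis by (simp add: C_def)
  qed
  with pos show ?thesis unfolding log_convex_def I_def[symmetric] by auto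
qed

lemma strict_antimono_set_integral:
  fixes h :: "real \<Rightarrow> 'a \<Rightarrow> real"
  assumes "\<And>q. q \<in> Q \<Longrightarrow> set_integrable M A (h q)"
    and "A \<in> sets M" "emeasure M A \<noteq> 0"
    and "\<And>t. t \<in> A \<Longrightarrow> strict_antimono_on Q (\<lambda>q. h q t)"
  shows "strict_antimono_on Q (\<lambda>q. LINT t:A|M. h q t)"
  using assms by (auto simp: monotone_on_def intro!: set_integral_strict_mono)

section \<open>Monotonicity and convexity of \<open>L\<close> and of its differences\<close>

text \<open>This is \<open>L a q\<close> from the overview; for \<open>a = - ln t\<close> with
  \<open>0 < t < 1\<close> it equals \<open>- ln (1 - t powr q)\<close>.\<close>

definition neg_ln_one_minus :: "real \<Rightarrow> real \<Rightarrow> real" where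
  "neg_ln_one_minus a q = - ln (1 - exp (- (a * q)))"

lemma DERIV_neg_ln_one_minus:
  assumes "a > 0" "q > 0"
  shows "(neg_ln_one_minus a has_real_derivative - a / (exp (a * q) - 1)) (at q)"
proof -
  have "exp (- (a * q)) < 1" using assms by simp
  then show ?thesis
    unfolding neg_ln_one_minus_def[abs_def]
    by (auto intro!: derivative_eq_intros simp: field_simps exp_minus)
qed

text \<open>Written as a square, the second derivative is visibly nonnegative, and comparing it for
  two parameters reduces to comparing the bases.\<close>

lemma DERIV2_neg_ln_one_minus:
  assumes "a > 0" "q > 0"
  shows "((\<lambda>q. - a / (exp (a * q) - 1)) has_real_derivative
    (a / (2 * sinh (a * q / 2)))\<^sup>2) (at q)"
proof -
  \<comment> \<open>In terms of this half exponent, both \<open>exp (a * q)\<close> and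
    \<open>sinh (a * q / 2)\<close> are rational.\<close>
  define e where "e = exp (a * q / 2)"
  have e: "e > 1" "e > 0" using assms by (auto simp: e_def)
  have ee: "exp (a * q) = e\<^sup>2"
    by (simp add: e_def power2_eq_square mult_exp_exp)
  have e2: "e\<^sup>2 > 1" using e by (simp add: one_less_power)
  then have "e * e \<noteq> 1" by (simp add: power2_eq_square)
  have s: "2 * sinh (a * q / 2) = (e\<^sup>2 - 1) / e"
    using e by (simp add: sinh_field_def exp_minus e_def[symmetric] field_simps power2_eq_square)
  show ?thesis
    unfolding s
    using e e2 \<open>e * e \<noteq> 1\<close>
    by (auto intro!: derivative_eq_intros simp: ee power2_eq_square)
qed

text \<open>\<open>sinh\<close> is convex on the nonnegative reals and vanishes at 0, so its chord
  from 0 to \<open>b * q\<close> lies above it at \<open>a * q\<close>.\<close>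

lemma divide_sinh_mono:
  fixes a b q :: real
  assumes "0 < a" "a \<le> b" "0 < q"
  shows "b / sinh (b * q) \<le> a / sinh (a * q)"
proof -
  have "convex_on {0..} (sinh :: real \<Rightarrow> real)"
    by (rule f''_ge0_imp_convex[where f' = cosh and f'' = sinh])
       (auto intro!: derivative_eq_intros)
  from convex_onD[OF this, of "a / b" 0 "b * q"] assms
  have "sinh (a * q) \<le> a / b * sinh (b * q)" by simp
  then show ?thesis using assms by (simp add: field_simps)
qed

text \<open>The reciprocal \<open>(exp (x * q) - 1) / x\<close> has positive derivative in
  \<open>x\<close>, because \<open>1 - u < exp (- u)\<close> for \<open>u = x * q\<close>.\<close>

lemma exp_minus_one_strict_mono:
  fixes a b q :: real
  assumes "0 < a" "a < b" "0 < q"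
  shows "b / (exp (b * q) - 1) < a / (exp (a * q) - 1)"
proof -
  have "(exp (a * q) - 1) / a < (exp (b * q) - 1) / b"
  proof (rule DERIV_pos_imp_increasing[OF assms(2)], goal_cases)
    case (1 x)
    then have x: "x > 0" using assms by simp
    have "1 - x * q < exp (- (x * q))"
      using exp_minus_greater[of "x * q"] x assms by simp
    then have "(1 - x * q) * exp (x * q) < exp (- (x * q)) * exp (x * q)"
      by simp
    then have "0 < (x * q * exp (x * q) - (exp (x * q) - 1)) / x\<^sup>2"
      using x by (simp add: mult_exp_exp algebra_simps)
    moreover have "((\<lambda>x. (exp (x * q) - 1) / x) has_real_derivative
        (x * q * exp (x * q) - (exp (x * q) - 1)) / x\<^sup>2) (at x)"
      using x by (auto intro!: derivative_eq_intros simp: power2_eq_square)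
    ultimately show ?case by blast
  qed
  then show ?thesis using assms by (simp add: field_simps)
qed

lemma neg_ln_one_minus_strict_antimono:
  assumes "a > 0"
  shows "strict_antimono_on {0<..} (neg_ln_one_minus a)"
  using assms by (auto simp: monotone_on_def neg_ln_one_minus_def)

lemma convex_neg_ln_one_minus:
  assumes "a > 0"
  shows "convex_on {0<..} (neg_ln_one_minus a)"
  using assms
  by (intro f''_ge0_imp_convex[OF _ DERIV_neg_ln_one_minus DERIV2_neg_ln_one_minus]) auto

text \<open>Both terms decrease in \<open>q\<close>, so their separate monotonicity does not settle
  the difference; the derivatives have to be compared.\<close>

lemma neg_ln_one_minus_diff_strict_antimono:
  assumes "0 < a" "a < b"
  shows "strict_antimono_on {0<..} (\<lambda>q. neg_ln_one_minus a q - neg_ln_one_minus b q)"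
proof (rule monotone_onI)
  fix x y :: real assume xy: "x \<in> {0<..}" "y \<in> {0<..}" "x < y"
  show "neg_ln_one_minus a x - neg_ln_one_minus b x > neg_ln_one_minus a y - neg_ln_one_minus b y"
  proof (rule DERIV_neg_imp_decreasing[OF xy(3)], goal_cases)
    case (1 q)
    with xy have "q > 0" by simp
    then have "((\<lambda>q. neg_ln_one_minus a q - neg_ln_one_minus b q) has_real_derivative
        - a / (exp (a * q) - 1) - - b / (exp (b * q) - 1)) (at q)"
      using assms by (intro DERIV_diff DERIV_neg_ln_one_minus) auto
    moreover have "- a / (exp (a * q) - 1) - - b / (exp (b * q) - 1) < 0"
      using exp_minus_one_strict_mono[OF assms \<open>q > 0\<close>] by simp
    ultimately show ?case by blast
  qed
qed

lemma convex_neg_ln_one_minus_diff: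
  assumes "0 < a" "a < b"
  shows "convex_on {0<..} (\<lambda>q. neg_ln_one_minus a q - neg_ln_one_minus b q)"
proof (rule f''_ge0_imp_convex)
  fix q :: real assume "q \<in> {0<..}"
  then have q: "q > 0" by simp
  show "((\<lambda>q. neg_ln_one_minus a q - neg_ln_one_minus b q) has_real_derivative
        - a / (exp (a * q) - 1) - - b / (exp (b * q) - 1)) (at q)"
    using assms q by (intro DERIV_diff DERIV_neg_ln_one_minus) auto
  show "((\<lambda>q. - a / (exp (a * q) - 1) - - b / (exp (b * q) - 1)) has_real_derivative
        (a / (2 * sinh (a * q / 2)))\<^sup>2 - (b / (2 * sinh (b * q / 2)))\<^sup>2) (at q)"
    using assms q by (intro DERIV_diff DERIV2_neg_ln_one_minus) auto
  have "b / (2 * sinh (b * q / 2)) \<le> a / (2 * sinh (a * q / 2))"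
    using divide_sinh_mono[of a b "q / 2"] assms q by (simp add: field_simps)
  then have "(b / (2 * sinh (b * q / 2)))\<^sup>2 \<le> (a / (2 * sinh (a * q / 2)))\<^sup>2"
    using assms q by (intro power_mono) auto
  then show "0 \<le> (a / (2 * sinh (a * q / 2)))\<^sup>2 - (b / (2 * sinh (b * q / 2)))\<^sup>2" by simp
qed auto

section \<open>Exponential form of \<open>1 - t powr q\<close> and integrability near
  \<open>t = 1\<close>\<close>

lemma one_minus_powr_eq_exp:
  assumes "0 < t" "t < 1" "q > 0"
  shows "1 - t powr q = exp (- neg_ln_one_minus (- ln t) q)"
proof -
  have "t powr q = exp (- (- ln t * q))"
    using assms by (simp add: powr_def mult.commute)
  moreover have "t powr q < 1"
    using assms powr_less_mono2[of q t 1] by simp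
  ultimately show ?thesis by (simp add: neg_ln_one_minus_def)
qed

text \<open>The integrand is nonnegative with an explicit antiderivative that has finite limits at
  both endpoints.\<close>

lemma set_integrable_one_minus_powr:
  fixes s :: real
  assumes "s < 1"
  shows "set_integrable lborel {0<..<1} (\<lambda>t. (1 - t) powr (- s))"
proof -
  let ?F = "\<lambda>t. - ((1 - t) powr (1 - s) / (1 - s))"
  \<comment> \<open>Continuity at 1 needs the exponent \<open>1 - s\<close> to be positive.\<close>
  have cont: "continuous_on {0..1} ?F"
    using assms
    by (intro continuous_on_minus continuous_on_divide continuous_on_powr' continuous_intros) auto
  have "set_integrable lborel (einterval 0 1) (\<lambda>t. (1 - t) powr (- s))"
  proof (rule interval_integral_FTC_nonneg(1)[where F = ?F and A = "?F 0" and B = "?F 1"])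
    fix x assume "0 < ereal x" "ereal x < 1"
    then have x: "0 < x" "x < 1" by auto
    show "(?F has_real_derivative (1 - x) powr (- s)) (at x)"
      using x assms by (auto intro!: derivative_eq_intros)
    show "isCont (\<lambda>t. (1 - t) powr (- s)) x"
      using x by (intro continuous_intros) auto
  next
    have "(?F \<longlongrightarrow> ?F 0) (at_right 0)" "(?F \<longlongrightarrow> ?F 1) (at_left 1)"
      using continuous_on_Icc_at_rightD[OF cont] continuous_on_Icc_at_leftD[OF cont] by auto
    then show "((?F \<circ> real_of_ereal) \<longlongrightarrow> ?F 0) (at_right 0)"
      "((?F \<circ> real_of_ereal) \<longlongrightarrow> ?F 1) (at_left 1)"
      by (simp_all add: zero_ereal_def one_ereal_def ereal_tendsto_simps)
  qed auto
  then show ?thesis by (simp add: zero_ereal_def one_ereal_def)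
qed

text \<open>For \<open>q \<ge> 1\<close> this is \<open>t powr q \<le> t\<close>; for
  \<open>q < 1\<close> it is Young's inequality for \<open>t\<close> and 1 with weights
  \<open>q\<close> and \<open>1 - q\<close>.\<close>

lemma one_minus_powr_ge:
  fixes t q :: real
  assumes "0 < t" "t < 1" "q > 0"
  shows "min 1 q * (1 - t) \<le> 1 - t powr q"
proof (cases "q \<ge> 1")
  case True
  then have "t powr q \<le> t powr 1" using assms by (intro powr_mono') auto
  then show ?thesis using True assms by simp
next
  case False
  then have "t powr q * 1 powr (1 - q) \<le> q * t + (1 - q) * 1"
    using assms by (intro Youngs_inequality_0) auto
  then show ?thesis using False by (simp add: algebra_simps)
qed

lemma set_integrable_inverse_one_minus_powr:
  fixes s q :: real
  assumes "0 < s" "s < 1" "q > 0"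
  shows "set_integrable lborel {0<..<1} (\<lambda>t. 1 / (1 - t powr q) powr s)"
proof (rule set_integrable_bound)
  \<comment> \<open>The factor of the lower bound \<open>min 1 q * (1 - t)\<close>, raised to the
    power \<open>- s\<close>, which reverses the inequality.\<close>
  let ?c = "min 1 q powr (- s)"
  show "set_integrable lborel {0<..<1} (\<lambda>t. ?c * (1 - t) powr (- s))"
    using set_integrable_one_minus_powr[OF assms(2)] by auto
  show "set_borel_measurable lborel {0<..<1} (\<lambda>t. 1 / (1 - t powr q) powr s)"
    unfolding set_borel_measurable_def by measurable
  have "1 / (1 - t powr q) powr s \<le> ?c * (1 - t) powr (- s)" if "0 < t" "t < 1" for t
  proof -
    have pos: "0 < min 1 q * (1 - t)" using that assms by auto
    have "1 / (1 - t powr q) powr s = (1 - t powr q) powr (- s)"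
      by (simp add: powr_minus_divide)
    also have "\<dots> \<le> (min 1 q * (1 - t)) powr (- s)"
      using one_minus_powr_ge[OF that assms(3)] pos assms by (intro powr_mono2') auto
    also have "\<dots> = ?c * (1 - t) powr (- s)"
      by (rule powr_mult)
    finally show ?thesis .
  qed
  then show "AE t in lborel. t \<in> {0<..<1} \<longrightarrow>
      norm (1 / (1 - t powr q) powr s) \<le> norm (?c * (1 - t) powr (- s))"
    by auto
qed

section \<open>The integrands of \<open>Khat\<close> and \<open>Epq\<close>\<close>

context
  fixes p r :: real
  assumes r: "0 < r" "r < 1" and p: "p > 1"
begin

text \<open>Since \<open>r powr q * t powr q = (r * t) powr q\<close>, both factors have the form
  \<open>1 - u powr q\<close> with \<open>0 < u < 1\<close>.\<close>

lemma Khat_integrand_eq: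
  assumes "t \<in> {0<..<1}" "q > 0"
  shows "1 / ((1 - t powr q) powr (1 / p) * (1 - r powr q * t powr q) powr (1 / p)) =
    exp (1 / p * (neg_ln_one_minus (- ln t) q + neg_ln_one_minus (- ln (r * t)) q))"
proof -
  have rt: "0 < r * t" "r * t < 1"
    using r assms mult_strict_mono[of r 1 t 1] by auto
  have "1 / (exp x powr s * exp y powr s) = exp (s * (- x + - y))" for x y s :: real
    by (simp add: powr_def exp_add exp_minus field_simps exp_diff)
  from this[of "- neg_ln_one_minus (- ln t) q" "1 / p" "- neg_ln_one_minus (- ln (r * t)) q"]
  show ?thesis
    using assms rt one_minus_powr_eq_exp[of t q] one_minus_powr_eq_exp[of "r * t" q] r
    by (simp add: powr_mult)
qed

lemma Epq_integrand_eq: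
  assumes "t \<in> {0<..<1}" "q > 0"
  shows "((1 - r powr q * t powr q) / (1 - t powr q)) powr (1 / p) =
    exp (1 / p * (neg_ln_one_minus (- ln t) q - neg_ln_one_minus (- ln (r * t)) q))"
proof -
  have rt: "0 < r * t" "r * t < 1"
    using r assms mult_strict_mono[of r 1 t 1] by auto
  have "(exp y / exp x) powr s = exp (s * (- x - - y))" for x y s :: real
    by (simp add: powr_def exp_diff[symmetric])
  from this[of "- neg_ln_one_minus (- ln (r * t)) q" "- neg_ln_one_minus (- ln t) q" "1 / p"]
  show ?thesis
    using assms rt one_minus_powr_eq_exp[of t q] one_minus_powr_eq_exp[of "r * t" q] r
    by (simp add: powr_mult)
qed

text \<open>Only the first factor is singular at \<open>t = 1\<close>; the reciprocal of the second
  is at most its value there, the constant \<open>?c\<close>.\<close>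

lemma Khat_integrable:
  assumes "q > 0"
  shows "set_integrable lborel {0<..<1}
    (\<lambda>t. 1 / ((1 - t powr q) powr (1 / p) * (1 - r powr q * t powr q) powr (1 / p)))"
proof (rule set_integrable_bound)
  let ?c = "1 / (1 - r powr q) powr (1 / p)"
  show "set_integrable lborel {0<..<1} (\<lambda>t. ?c * (1 / (1 - t powr q) powr (1 / p)))"
    using p assms
    by (intro set_integrable_mult_right set_integrable_inverse_one_minus_powr) auto
  show "set_borel_measurable lborel {0<..<1}
      (\<lambda>t. 1 / ((1 - t powr q) powr (1 / p) * (1 - r powr q * t powr q) powr (1 / p)))"
    unfolding set_borel_measurable_def by measurable
  have "1 / ((1 - t powr q) powr (1 / p) * (1 - r powr q * t powr q) powr (1 / p))
      \<le> ?c * (1 / (1 - t powr q) powr (1 / p))" if "0 < t" "t < 1" for t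
  proof -
    have tq: "t powr q < 1" and rq: "r powr q < 1"
      using that assms r powr_less_mono2[of q t 1] powr_less_mono2[of q r 1] by auto
    have "r powr q * t powr q \<le> r powr q * 1"
      using tq by (intro mult_left_mono) auto
    then have le: "(1 - r powr q) powr (1 / p) \<le> (1 - r powr q * t powr q) powr (1 / p)"
      using p rq by (intro powr_mono2) auto
    have "1 / (1 - r powr q * t powr q) powr (1 / p) \<le> ?c"
      using rq le by (intro divide_left_mono) (auto intro!: mult_pos_pos simp: less_le_trans)
    then have "1 / (1 - r powr q * t powr q) powr (1 / p) * (1 / (1 - t powr q) powr (1 / p))
       \<le> ?c * (1 / (1 - t powr q) powr (1 / p))"
      by (intro mult_right_mono) auto
    then show ?thesis by (simp add: mult.commute)
  qed
  then show "AE t in lborel. t \<in> {0<..<1} \<longrightarrow>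
      norm (1 / ((1 - t powr q) powr (1 / p) * (1 - r powr q * t powr q) powr (1 / p)))
      \<le> norm (?c * (1 / (1 - t powr q) powr (1 / p)))"
    by auto
qed

text \<open>The numerator lies between 0 and 1, so the singularity is that of the denominator
  alone.\<close>

lemma Epq_integrable:
  assumes "q > 0"
  shows "set_integrable lborel {0<..<1}
    (\<lambda>t. ((1 - r powr q * t powr q) / (1 - t powr q)) powr (1 / p))"
proof (rule set_integrable_bound)
  show "set_integrable lborel {0<..<1} (\<lambda>t. 1 / (1 - t powr q) powr (1 / p))"
    using set_integrable_inverse_one_minus_powr[of "1 / p" q] p assms by auto
  show "set_borel_measurable lborel {0<..<1}
      (\<lambda>t. ((1 - r powr q * t powr q) / (1 - t powr q)) powr (1 / p))"
    unfolding set_borel_measurable_def by measurable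
  have "((1 - r powr q * t powr q) / (1 - t powr q)) powr (1 / p)
      \<le> 1 / (1 - t powr q) powr (1 / p)" if "0 < t" "t < 1" for t
  proof -
    have tq: "t powr q < 1" and rq: "r powr q < 1"
      using that assms r powr_less_mono2[of q t 1] powr_less_mono2[of q r 1] by auto
    have "r powr q * t powr q \<le> 1 * 1"
      using tq rq by (intro mult_mono) auto
    then have "((1 - r powr q * t powr q) / (1 - t powr q)) powr (1 / p)
        \<le> (1 / (1 - t powr q)) powr (1 / p)"
      using p tq by (intro powr_mono2 divide_right_mono) auto
    then show ?thesis using tq by (simp add: powr_divide)
  qed
  then show "AE t in lborel. t \<in> {0<..<1} \<longrightarrow>
      norm (((1 - r powr q * t powr q) / (1 - t powr q)) powr (1 / p))
      \<le> norm (1 / (1 - t powr q) powr (1 / p))"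
    by auto
qed

end

section \<open>From exponents to integrals\<close>

text \<open>Needed because the exponential form of the integrands is established for positive
  \<open>q\<close> only.\<close>

lemma log_convex_cong:
  assumes "\<And>q. q > 0 \<Longrightarrow> f q = g q"
  shows "log_convex f \<longleftrightarrow> log_convex g"
proof -
  have "\<theta> * x + (1 - \<theta>) * y > 0" if "x > 0" "y > 0" "\<theta> \<in> {0..1}" for \<theta> x y :: real
    using that by (cases "\<theta> = 0") (auto intro: add_pos_nonneg)
  then show ?thesis by (simp add: log_convex_def assms)
qed

text \<open>Common to both integrals, with \<open>c = 1 / p\<close> and \<open>f t\<close> the sum
  of two values of \<open>L\<close> for \<open>Khat\<close> and their difference for
  \<open>Epq\<close>.\<close>

lemma set_integral_exp_scaled:
  fixes h :: "real \<Rightarrow> 'a \<Rightarrow> real"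
  assumes c: "c > 0"
    and int: "\<And>q. q > 0 \<Longrightarrow> set_integrable M A (h q)"
    and A: "A \<in> sets M" "emeasure M A \<noteq> 0"
    and h: "\<And>q t. q > 0 \<Longrightarrow> t \<in> A \<Longrightarrow> h q t = exp (c * f t q)"
    and convex: "\<And>t. t \<in> A \<Longrightarrow> convex_on {0<..} (f t)"
    and anti: "\<And>t. t \<in> A \<Longrightarrow> strict_antimono_on {0<..} (f t)"
  shows "strict_antimono_on {0<..} (\<lambda>q. LINT t:A|M. h q t)"
    and "log_convex (\<lambda>q. LINT t:A|M. h q t)"
proof -
  show "strict_antimono_on {0<..} (\<lambda>q. LINT t:A|M. h q t)"
    using int anti c by (intro strict_antimono_set_integral A) (auto simp: monotone_on_def h)
  show "log_convex (\<lambda>q. LINT t:A|M. h q t)"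
  proof (intro log_convex_set_integral int A)
    fix t assume t: "t \<in> A"
    have "log_convex (\<lambda>q. exp (c * f t q))"
      using c convex[OF t] by (intro log_convex_exp convex_on_cmul) auto
    then show "log_convex (\<lambda>q. h q t)"
      using t by (subst log_convex_cong[where g = "\<lambda>q. exp (c * f t q)"]) (auto simp: h)
  qed
qed

theorem theorem2p7:
  fixes p r :: real
  assumes "0 < r" and "r < 1" and "p > 1"
  shows "(strict_antimono_on {0<..} (\<lambda>q. Khat p q r) \<and> log_convex (\<lambda>q. Khat p q r)) \<and>
    (strict_antimono_on {0<..} (\<lambda>q. Epq p q r) \<and> log_convex (\<lambda>q. Epq p q r)) \<and>
    (\<forall>q>1. (Khat p q r)\<^sup>2 \<le> Khat p (q - 1) r * Khat p (q + 1) r) \<and>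
    (\<forall>q>1. (Epq p q r)\<^sup>2 \<le> Epq p (q - 1) r * Epq p (q + 1) r)"
proof -
  have ab: "0 < - ln t" "- ln t < - ln (r * t)" "0 < - ln (r * t)" if "t \<in> {0<..<1}" for t
  proof -
    show "0 < - ln t" using that by simp
    moreover show "- ln t < - ln (r * t)" using that assms by (simp add: ln_mult)
    ultimately show "0 < - ln (r * t)" by linarith
  qed
  have em: "{0<..<1} \<in> sets (lborel :: real measure)" "emeasure lborel {0<..<1::real} \<noteq> 0"
    by auto
  have p: "1 / p > 0" using assms by simp
  have anti: "strict_antimono_on {0<..}
      (\<lambda>q. neg_ln_one_minus (- ln t) q + neg_ln_one_minus (- ln (r * t)) q)"
    if "t \<in> {0<..<1}" for t
    using neg_ln_one_minus_strict_antimono[OF ab(1)[OF that]]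
      neg_ln_one_minus_strict_antimono[OF ab(3)[OF that]]
    by (auto simp: monotone_on_def intro: add_strict_mono)
  note K = set_integral_exp_scaled[OF p Khat_integrable[OF assms] em Khat_integrand_eq[OF assms]
      convex_on_add[OF convex_neg_ln_one_minus[OF ab(1)] convex_neg_ln_one_minus[OF ab(3)]] anti,
      folded Khat_def]
  note E = set_integral_exp_scaled[OF p Epq_integrable[OF assms] em Epq_integrand_eq[OF assms]
      convex_neg_ln_one_minus_diff[OF ab(1,2)] neg_ln_one_minus_diff_strict_antimono[OF ab(1,2)],
      folded Epq_def]
  show ?thesis
    using K E log_convex_turan[OF K(2)] log_convex_turan[OF E(2)] by simp
qed

end
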